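(* For every nonempty finite set $I$ of nonnegative integers, with $d=\max I$, there exists a closed convex set $S\subseteq \mathbb{R}^d$ such that $I$ is the facial dimension signature of $S$. More specifically, $S$ can be chosen so that all of the following hold simultaneously: (i) $S$ is facially exposed; (ii) $S$ can be represented as the solution set of a system of $|I|-1$ convex quadratic inequalities in $\mathbb{R}^d$; (iii) if $0\in I$, then in addition $S$ is compact.
   Context: A convex subset $F$ of a convex set $C\subseteq\mathbb{R}^n$ is a face of $C$ if for any $x,y\in C$ whose open segment $(x,y)$ meets $F$ one has $x,y\in F$ (with the convention $(x,x)=\{x\}$). The dimension of a convex set is the dimension of the smallest affine subspace containing it. The facial dimension signature of $C$ is the set $\{\dim F : F \text{ a nonempty face of } C\}$ of nonnegative integers (note that $C$ is a face of itself). A face $F$ of a convex set $C$ is exposed if there is a closed half-space $H$ with $C\subseteq H$ such that the intersection of the boundary hyperplane of $H$ with $C$ is exactly $F$. A convex set is facially exposed if every nonempty proper face of it is exposed (empty faces are disregarded). A convex quadratic inequality in $\mathbb{R}^n$ is an inequality $f(x)\le 0$ with $f(x)=\langle Ax,x\rangle+\langle a,x\rangle+\alpha$, where $A$ is a symmetric positive semidefinite $n\times n$ matrix (possibly zero), $a\in\mathbb{R}^n$, $\alpha\in\mathbb{R}$. The solution set of an empty system of inequalities in $\mathbb{R}^d$ is $\mathbb{R}^d$, and $\mathbb{R}^0=\{0\}$. *)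

theory Defs
  imports "HOL-Analysis.Analysis"
begin

text \<open>
  Since the index type \<open>'n\<close> of \<open>real ^ 'n\<close> is never empty, the theorem models the space R^d,
  d = 0 included, by an arbitrary \<open>d\<close>-dimensional linear subspace \<open>V\<close> of \<open>real ^ 'n\<close>.
  The case \<open>V = UNIV\<close> is the coordinate space R^d for \<open>d = CARD('n)\<close>, and \<open>V = {0}\<close> is R^0.
  Nothing is lost by using ambient notions for subsets of \<open>V\<close>: \<open>V\<close> is closed, and by
  orthogonal projection and extension by zero the half-spaces of \<open>V\<close> and the convex quadratic
  functions on \<open>V\<close> are exactly the restrictions of ambient ones (an ambient half-space whose
  boundary is parallel to \<open>V\<close> never exposes a nonempty proper face).
\<close>

text \<open>
  The library's \<open>open_segment x x\<close> is empty rather than \<open>{x}\<close>; this does not affect \<open>face_of\<close>.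
\<close>

definition facial_dimension_signature :: "(real ^ 'n) set \<Rightarrow> nat set" where
  "facial_dimension_signature C =
     {k. \<exists>F. F face_of C \<and> F \<noteq> {} \<and> aff_dim F = int k}"

text \<open>
  In \<open>exposed_face_of\<close> the normal vector of the half-space may be zero, but then the face is
  empty or all of \<open>C\<close>; so for nonempty proper faces the half-space is a genuine one.
\<close>

definition facially_exposed :: "(real ^ 'n) set \<Rightarrow> bool" where
  "facially_exposed C \<longleftrightarrow>
     (\<forall>F. F face_of C \<and> F \<noteq> {} \<and> F \<noteq> C \<longrightarrow> F exposed_face_of C)"

definition convex_quadratic :: "(real ^ 'n \<Rightarrow> real) \<Rightarrow> bool" where
  "convex_quadratic f \<longleftrightarrow>
     (\<exists>(A :: real ^ 'n ^ 'n) a \<alpha>.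
        transpose A = A \<and> (\<forall>x. 0 \<le> (A *v x) \<bullet> x) \<and>
        (\<forall>x. f x = (A *v x) \<bullet> x + a \<bullet> x + \<alpha>))"

end

theory Submission
  imports Defs
begin

text \<open>
  Fix an orthonormal basis \<open>b 0, \<dots>, b (d - 1)\<close> of \<open>V\<close>, let \<open>q n x\<close> be the squared norm of the
  projection of \<open>x\<close> that forgets the first \<open>n\<close> coordinates, and take
  \<open>S = {x \<in> V. \<forall>n\<in>I. q n x \<le> d - n}\<close>.
  The inequality for \<open>n = d\<close> reads \<open>0 \<le> 0\<close>, which leaves \<open>|I| - 1\<close> convex quadratic inequalities;
  the one for \<open>n = 0\<close> says that \<open>S\<close> lies in a ball, which gives compactness when \<open>0 \<in> I\<close>.

  For \<open>n < d\<close> each inequality alone describes a solid cylinder over a round ball, and its proper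
  nonempty faces are the \<open>n\<close>-dimensional affine subspaces obtained by fixing the last \<open>d - n\<close> coordinates at
  a point of the sphere.  The point is that the cylinders interact trivially.  Let \<open>z \<in> S\<close> and let
  \<open>n\<close> be the least element of \<open>I\<close> with \<open>q n z = d - n\<close>; there is one because \<open>d\<close> always qualifies.
  Fixing the coordinates of \<open>z\<close> from \<open>n\<close> on cuts out an exposed face of \<open>S\<close> containing \<open>z\<close>.  On it,
  the inequalities with index at least \<open>n\<close> hold automatically, because they only see fixed
  coordinates, and those with smaller index are strict at \<open>z\<close>, hence near \<open>z\<close>.  So this face
  has dimension exactly \<open>n\<close> and \<open>z\<close> in its relative interior (lemmas
  \<open>aff_dim_fiber\<close> and \<open>rel_interior_fiber\<close>).  As distinct faces have disjoint relative interiors,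
  every nonempty face arises in this way (lemma \<open>face_is_fiber\<close>).  Taking \<open>n = d\<close> accounts for
  \<open>S\<close> itself.

  Conversely every \<open>n \<in> I\<close> occurs as a least tight index, because the bounds \<open>d - n\<close> strictly
  decrease: at the point \<open>z = sqrt (d - n) b n\<close> one has \<open>q k z = d - n < d - k\<close> for \<open>k < n\<close>, and
  \<open>q k z = 0\<close> for \<open>k > n\<close>.
\<close>

section \<open>Nested cylinders over an orthonormal basis\<close>

locale nested_cylinders =
  fixes b :: "nat \<Rightarrow> 'a::euclidean_space" and d :: nat and I :: "nat set" and V :: "'a set"
  assumes orthonormal: "\<And>i j. i < d \<Longrightarrow> j < d \<Longrightarrow> b i \<bullet> b j = (if i = j then 1 else 0)"
    and span_basis: "span (b ` {..<d}) = V"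
    and dim_in_I: "d \<in> I"
    and I_le_dim: "\<And>n. n \<in> I \<Longrightarrow> n \<le> d"
begin

definition q :: "nat \<Rightarrow> 'a \<Rightarrow> real" where
  "q n x = (\<Sum>i=n..<d. (x \<bullet> b i)\<^sup>2)"

definition S :: "'a set" where
  "S = {x \<in> V. \<forall>n\<in>I. q n x \<le> real d - real n}"

definition flat :: "nat \<Rightarrow> 'a \<Rightarrow> 'a set" where
  "flat n z = {x \<in> V. \<forall>i\<in>{n..<d}. x \<bullet> b i = z \<bullet> b i}"

definition fiber :: "nat \<Rightarrow> 'a \<Rightarrow> 'a set" where
  "fiber n z = S \<inter> flat n z"

definition least_tight :: "nat \<Rightarrow> 'a \<Rightarrow> bool" where
  "least_tight n z \<longleftrightarrow>
     n \<in> I \<and> q n z = real d - real n \<and> (\<forall>k\<in>I. k < n \<longrightarrow> q k z < real d - real k)"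

lemma subspace_V: "subspace V"
  unfolding span_basis[symmetric] by (rule subspace_span)

lemma basis_in_V: "i < d \<Longrightarrow> b i \<in> V"
  unfolding span_basis[symmetric] by (intro span_base imageI) simp

lemma inj_on_basis: "inj_on b {..<d}"
proof (rule inj_onI)
  fix i j assume ij: "i \<in> {..<d}" "j \<in> {..<d}" "b i = b j"
  then have "b i \<bullet> b j = 1"
    using orthonormal[of j j] by simp
  then show "i = j"
    using ij orthonormal[of i j] by (simp split: if_splits)
qed

lemma finite_I: "finite I"
  by (rule finite_subset[of _ "{..d}"]) (auto simp: I_le_dim)

lemma norm_basis: "i < d \<Longrightarrow> norm (b i) = 1"
  by (simp add: norm_eq_sqrt_inner orthonormal)

lemma pairwise_orthogonal_basis: "pairwise orthogonal (b ` {..<d})"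
proof (rule pairwiseI)
  fix v w assume "v \<in> b ` {..<d}" "w \<in> b ` {..<d}" "v \<noteq> w"
  then obtain i j where "i < d" "j < d" "v = b i" "w = b j" "i \<noteq> j"
    by blast
  then show "orthogonal v w"
    by (simp add: orthogonal_def orthonormal)
qed

lemma basis_expand:
  assumes "x \<in> V"
  shows "(\<Sum>i<d. (x \<bullet> b i) *\<^sub>R b i) = x"
proof -
  have "(\<Sum>v\<in>b ` {..<d}. (x \<bullet> v) *\<^sub>R v) = x"
    using assms norm_basis
    by (intro orthonormal_basis_expand pairwise_orthogonal_basis) (auto simp: span_basis)
  then show ?thesis
    by (simp add: sum.reindex[OF inj_on_basis])
qed

lemma independent_basis: "n \<le> d \<Longrightarrow> independent (b ` {..<n})"
proof (rule pairwise_orthogonal_independent)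
  assume "n \<le> d"
  then show "pairwise orthogonal (b ` {..<n})"
    by (intro pairwise_subset[OF pairwise_orthogonal_basis] image_mono) auto
  show "0 \<notin> b ` {..<n}"
    using norm_basis \<open>n \<le> d\<close> by (metis imageE lessThan_iff norm_zero order_less_le_trans zero_neq_one)
qed

subsection \<open>The intersection of the cylinders\<close>

lemma continuous_on_q: "continuous_on A (q n)"
  unfolding q_def by (intro continuous_intros)

lemma convex_on_q: "convex_on UNIV (q n)"
proof -
  have "convex_on UNIV (\<lambda>x. (x \<bullet> b i)\<^sup>2)" for i
  proof (rule convex_onI)
    fix t :: real and x y :: 'a
    assume t: "0 < t" "t < 1"
    show "(((1 - t) *\<^sub>R x + t *\<^sub>R y) \<bullet> b i)\<^sup>2 \<le> (1 - t) * (x \<bullet> b i)\<^sup>2 + t * (y \<bullet> b i)\<^sup>2"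
      using convex_onD[OF convex_power2, of t "x \<bullet> b i" "y \<bullet> b i"] t
      by (simp add: inner_add_left)
  qed simp
  then have "(u * (x \<bullet> b i) + v * (y \<bullet> b i))\<^sup>2 \<le> u * (x \<bullet> b i)\<^sup>2 + v * (y \<bullet> b i)\<^sup>2"
    if "0 \<le> u" "0 \<le> v" "u + v = 1" for x y u v i
    using that by (simp add: convex_on_def inner_add_left)
  then show ?thesis
    unfolding convex_on_def q_def
    by (simp add: inner_add_left sum_distrib_left sum_mono flip: sum.distrib)
qed

lemma S_eq_Inter: "S = V \<inter> (\<Inter>n\<in>I. {x. q n x \<le> real d - real n})"
  by (auto simp: S_def)

lemma closed_S: "closed S"
  unfolding S_eq_Inter
  by (intro closed_Int closed_INT closed_subspace subspace_V ballI closed_Collect_le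
      continuous_on_q continuous_on_const)

lemma convex_S: "convex S"
proof -
  have "convex {x. q n x \<le> c}" for n c
  proof (rule convexI, clarify)
    fix x y :: 'a and u v :: real
    assume *: "q n x \<le> c" "q n y \<le> c" "0 \<le> u" "0 \<le> v" "u + v = 1"
    then have "q n (u *\<^sub>R x + v *\<^sub>R y) \<le> u * q n x + v * q n y"
      using convex_on_q[of n] by (simp add: convex_on_def)
    also have "\<dots> \<le> c"
      using * by (intro convex_bound_le)
    finally show "q n (u *\<^sub>R x + v *\<^sub>R y) \<le> c" .
  qed
  then show ?thesis
    unfolding S_eq_Inter
    by (intro convex_Int convex_INT subspace_imp_convex[OF subspace_V])
qed

lemma q_0: "x \<in> V \<Longrightarrow> q 0 x = (norm x)\<^sup>2"
proof -
  assume "x \<in> V"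
  then have "x \<bullet> x = x \<bullet> (\<Sum>i<d. (x \<bullet> b i) *\<^sub>R b i)"
    by (simp only: basis_expand)
  also have "\<dots> = q 0 x"
    by (simp add: q_def inner_sum_right power2_eq_square atLeast0LessThan)
  finally show ?thesis
    by (simp add: power2_norm_eq_inner)
qed

lemma compact_S: "compact S" if "0 \<in> I"
proof -
  have "norm x \<le> sqrt (real d)" if "x \<in> S" for x
    using that \<open>0 \<in> I\<close> q_0[of x] by (force simp: S_def intro: real_le_rsqrt)
  then have "bounded S"
    by (auto simp: bounded_iff)
  then show ?thesis
    using closed_S by (simp add: compact_eq_bounded_closed)
qed

subsection \<open>Fibers of the coordinate projections\<close>

lemma affine_flat: "affine (flat n z)"
proof -
  have "flat n z = V \<inter> (\<Inter>i\<in>{n..<d}. {x. b i \<bullet> x = z \<bullet> b i})"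
    by (auto simp: flat_def inner_commute)
  then show ?thesis
    using subspace_imp_affine[OF subspace_V]
    by (auto intro!: affine_Int affine_Inter affine_hyperplane)
qed

lemma aff_dim_flat:
  assumes "z \<in> V" "n \<le> d"
  shows "aff_dim (flat n z) = int n"
proof -
  have "flat n z = (+) z ` span (b ` {..<n})"
  proof (intro equalityI subsetI)
    fix x assume x: "x \<in> flat n z"
    then have "x - z \<in> V"
      using assms subspace_V by (auto simp: flat_def subspace_diff)
    then have "x - z = (\<Sum>i<d. ((x - z) \<bullet> b i) *\<^sub>R b i)"
      by (simp only: basis_expand)
    also have "\<dots> = (\<Sum>i<n. ((x - z) \<bullet> b i) *\<^sub>R b i)"
      using x assms by (intro sum.mono_neutral_right) (auto simp: flat_def inner_diff_left)
    also have "\<dots> \<in> span (b ` {..<n})"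
      by (intro span_sum span_scale span_base) auto
    finally show "x \<in> (+) z ` span (b ` {..<n})"
      by (intro image_eqI[of _ _ "x - z"]) auto
  next
    fix x assume "x \<in> (+) z ` span (b ` {..<n})"
    then obtain w where w: "w \<in> span (b ` {..<n})" "x = z + w"
      by blast
    have "span (b ` {..<n}) \<subseteq> span (b ` {..<d})"
      using assms by (intro span_mono) auto
    then have "w \<in> V"
      using w span_basis by auto
    moreover have "w \<bullet> b i = 0" if "i \<in> {n..<d}" for i
    proof -
      have "span (b ` {..<n}) \<subseteq> {w. b i \<bullet> w = 0}"
        using that by (intro span_minimal subspace_hyperplane) (auto simp: orthonormal)
      then show ?thesis
        using w by (auto simp: inner_commute)
    qed
    ultimately show "x \<in> flat n z"
      using w assms subspace_V by (auto simp: flat_def subspace_add inner_add_left)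
  qed
  moreover have "dim (b ` {..<n}) = n"
    using independent_basis[OF assms(2)] inj_on_subset[OF inj_on_basis, of "{..<n}"] assms(2)
    by (simp add: dim_eq_card_independent card_image)
  ultimately show ?thesis
    by (simp add: aff_dim_translation_eq aff_dim_subspace)
qed

text \<open>
  The projection \<open>a\<close> of \<open>z\<close> to the last \<open>d - n\<close> coordinates is a normal vector: the squared distance
  between the projections of \<open>x\<close> and \<open>z\<close> is \<open>q n x - 2 * (a \<bullet> x) + q n z\<close>, so \<open>a \<bullet> x\<close> is at most
  \<open>d - n\<close> on \<open>S\<close>, and equality forces \<open>x\<close> and \<open>z\<close> to agree in these coordinates.
\<close>
lemma exposed_fiber:
  assumes "n \<in> I" "q n z = real d - real n"
  shows "fiber n z exposed_face_of S"
proof -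
  define a where "a = (\<Sum>i=n..<d. (z \<bullet> b i) *\<^sub>R b i)"
  define r where "r = real d - real n"
  have ax: "a \<bullet> x = (\<Sum>i=n..<d. (z \<bullet> b i) * (x \<bullet> b i))" for x
    by (simp add: a_def inner_sum_left inner_commute[of x])
  have polar: "(\<Sum>i=n..<d. (x \<bullet> b i - z \<bullet> b i)\<^sup>2) = q n x - 2 * (a \<bullet> x) + q n z" for x
    by (simp add: q_def ax power2_diff sum.distrib sum_subtractf sum_distrib_left mult_ac)
  have qx: "q n x \<le> r" if "x \<in> S" for x
    using that assms by (auto simp: S_def r_def)
  have le: "a \<bullet> x \<le> r" if "x \<in> S" for x
    using qx[OF that] polar[of x] assms
      sum_nonneg[of "{n..<d}" "\<lambda>i. (x \<bullet> b i - z \<bullet> b i)\<^sup>2"] by (simp add: r_def)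
  have "fiber n z = S \<inter> {x. a \<bullet> x = r}"
  proof (intro equalityI subsetI)
    fix x assume "x \<in> fiber n z"
    then have "x \<in> S" "\<forall>i\<in>{n..<d}. x \<bullet> b i = z \<bullet> b i"
      by (auto simp: fiber_def flat_def)
    then show "x \<in> S \<inter> {x. a \<bullet> x = r}"
      using assms by (simp add: ax q_def r_def power2_eq_square)
  next
    fix x assume x: "x \<in> S \<inter> {x. a \<bullet> x = r}"
    then have "(\<Sum>i=n..<d. (x \<bullet> b i - z \<bullet> b i)\<^sup>2) \<le> 0"
      using qx[of x] polar[of x] assms by (simp add: r_def)
    then have "(\<Sum>i=n..<d. (x \<bullet> b i - z \<bullet> b i)\<^sup>2) = 0"
      by (intro antisym sum_nonneg) auto
    then show "x \<in> fiber n z"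
      using x by (auto simp: sum_nonneg_eq_0_iff fiber_def flat_def S_def)
  qed
  then show ?thesis
    using exposed_face_of_Int_supporting_hyperplane_le[OF convex_S, of a r] le by simp
qed

text \<open>
  The open set is where the inequalities of index below \<open>n\<close> are strict; the other ones are
  constant along the flat and so hold throughout it.
\<close>
lemma flat_Int_open_subset_fiber:
  assumes "z \<in> S" "least_tight n z"
  obtains U where "open U" "z \<in> U" "flat n z \<inter> U \<subseteq> fiber n z"
proof
  define U where "U = (\<Inter>k\<in>{k \<in> I. k < n}. {x. q k x < real d - real k})"
  show "open U"
    unfolding U_def using finite_I
    by (intro open_INT ballI open_Collect_less continuous_on_q continuous_on_const) auto
  show "z \<in> U"
    using assms by (auto simp: U_def least_tight_def)
  show "flat n z \<inter> U \<subseteq> fiber n z"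
  proof
    fix x assume x: "x \<in> flat n z \<inter> U"
    have "q k x \<le> real d - real k" if "k \<in> I" for k
    proof (cases "k < n")
      case True
      then show ?thesis
        using x that by (force simp: U_def)
    next
      case False
      then have "q k x = q k z"
        unfolding q_def using x by (intro sum.cong) (auto simp: flat_def)
      then show ?thesis
        using assms that by (simp add: S_def)
    qed
    then show "x \<in> fiber n z"
      using x by (auto simp: fiber_def S_def flat_def)
  qed
qed

lemma affine_hull_fiber:
  assumes "z \<in> S" "least_tight n z"
  shows "affine hull (fiber n z) = flat n z"
proof
  show "affine hull (fiber n z) \<subseteq> flat n z"
    by (intro hull_minimal affine_flat) (auto simp: fiber_def)
  obtain U where U: "open U" "z \<in> U" "flat n z \<inter> U \<subseteq> fiber n z"
    using flat_Int_open_subset_fiber[OF assms] .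
  have "z \<in> flat n z"
    using assms by (auto simp: flat_def S_def)
  then have "affine hull (flat n z \<inter> U) = affine hull (flat n z)"
    using U by (intro affine_hull_affine_Int_open affine_flat) auto
  then show "flat n z \<subseteq> affine hull (fiber n z)"
    using hull_mono[OF U(3), of affine] hull_subset[of "flat n z" affine] by simp
qed

lemma aff_dim_fiber:
  assumes "z \<in> S" "least_tight n z"
  shows "aff_dim (fiber n z) = int n"
proof -
  have "aff_dim (fiber n z) = aff_dim (flat n z)"
    using affine_hull_fiber[OF assms] by (metis aff_dim_affine_hull)
  then show ?thesis
    using assms I_le_dim by (simp add: aff_dim_flat S_def least_tight_def)
qed

lemma rel_interior_fiber:
  assumes "z \<in> S" "least_tight n z"
  shows "z \<in> rel_interior (fiber n z)"
proof -
  obtain U where "open U" "z \<in> U" "flat n z \<inter> U \<subseteq> fiber n z"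
    using flat_Int_open_subset_fiber[OF assms] .
  moreover have "z \<in> fiber n z"
    using assms by (auto simp: fiber_def flat_def S_def)
  ultimately show ?thesis
    unfolding mem_rel_interior affine_hull_fiber[OF assms] by blast
qed

subsection \<open>Classification of the faces\<close>

lemma least_tight_exists:
  assumes "z \<in> S"
  obtains n where "least_tight n z"
proof -
  define P where "P n \<longleftrightarrow> n \<in> I \<and> q n z = real d - real n" for n
  have "P d"
    using dim_in_I by (simp add: P_def q_def)
  then obtain n where n: "P n" "\<And>k. k < n \<Longrightarrow> \<not> P k"
    using exists_least_iff[of P] by blast
  have "q k z < real d - real k" if "k \<in> I" "k < n" for k
  proof -
    have "q k z \<le> real d - real k"
      using assms that by (simp add: S_def)
    moreover have "q k z \<noteq> real d - real k"
      using n(2)[OF \<open>k < n\<close>] that by (simp add: P_def)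
    ultimately show ?thesis
      by simp
  qed
  then have "least_tight n z"
    using n(1) by (simp add: P_def least_tight_def)
  then show thesis ..
qed

text \<open>
  A relative interior point \<open>z\<close> of the face is also one of the fiber through \<open>z\<close>, and two faces
  whose relative interiors meet coincide.
\<close>
lemma face_is_fiber:
  assumes "F face_of S" "F \<noteq> {}"
  obtains n z where "z \<in> S" "least_tight n z" "F = fiber n z"
proof -
  have "rel_interior F \<noteq> {}"
    using assms by (simp add: rel_interior_eq_empty face_of_imp_convex)
  then obtain z where z: "z \<in> rel_interior F"
    by blast
  then have "z \<in> S"
    using assms rel_interior_subset face_of_imp_subset by blast
  then obtain n where n: "least_tight n z"
    using least_tight_exists by blast
  have "fiber n z face_of S"
    using exposed_fiber n by (auto simp: least_tight_def exposed_face_of_def)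
  then have "F = fiber n z"
    using assms z rel_interior_fiber[OF \<open>z \<in> S\<close> n] by (intro face_of_eq) auto
  then show thesis
    using that \<open>z \<in> S\<close> n by blast
qed

lemma faces_exposed: "F face_of S \<Longrightarrow> F \<noteq> {} \<Longrightarrow> F exposed_face_of S"
  by (metis face_is_fiber exposed_fiber least_tight_def)

lemma least_tight_point:
  assumes "n \<in> I"
  obtains z where "z \<in> S" "least_tight n z"
proof
  \<comment> \<open>For \<open>n = d\<close> this is the origin, whatever the value of \<open>b d\<close>.\<close>
  define z where "z = sqrt (real d - real n) *\<^sub>R b n"
  have "n \<le> d"
    using I_le_dim assms .
  have "(z \<bullet> b i)\<^sup>2 = (if i = n then real d - real n else 0)" if "i < d" for i
    using that orthonormal[of n i] \<open>n \<le> d\<close>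
    by (cases "n < d") (auto simp: z_def power_mult_distrib)
  then have q: "q k z = (if k \<le> n then real d - real n else 0)" for k
    using \<open>n \<le> d\<close> by (cases "n < d") (auto simp: q_def)
  have "z \<in> V"
    using \<open>n \<le> d\<close> basis_in_V subspace_V
    by (cases "n < d") (auto simp: z_def subspace_scale subspace_0)
  then show "z \<in> S"
    using I_le_dim by (auto simp: S_def q)
  show "least_tight n z"
    using assms by (auto simp: least_tight_def q)
qed

lemma face_dimensions:
  "(\<exists>F. F face_of S \<and> F \<noteq> {} \<and> aff_dim F = int k) \<longleftrightarrow> k \<in> I"
proof
  assume "\<exists>F. F face_of S \<and> F \<noteq> {} \<and> aff_dim F = int k"
  then obtain n z where "z \<in> S" "least_tight n z" "aff_dim (fiber n z) = int k"
    by (metis face_is_fiber)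
  then show "k \<in> I"
    using aff_dim_fiber by (auto simp: least_tight_def)
next
  assume "k \<in> I"
  then obtain z where z: "z \<in> S" "least_tight k z"
    by (rule least_tight_point)
  then have "fiber k z face_of S"
    using exposed_fiber by (auto simp: least_tight_def exposed_face_of_def)
  moreover have "fiber k z \<noteq> {}"
    using rel_interior_fiber[OF z] rel_interior_subset by blast
  ultimately show "\<exists>F. F face_of S \<and> F \<noteq> {} \<and> aff_dim F = int k"
    using aff_dim_fiber[OF z] by blast
qed

end

section \<open>The system of convex quadratic inequalities\<close>

lemma convex_quadratic_sum_squares:
  fixes b :: "'i \<Rightarrow> real ^ 'n"
  shows "convex_quadratic (\<lambda>x. (\<Sum>i\<in>J. (x \<bullet> b i)\<^sup>2) - c)"
proof -
  \<comment> \<open>The Gram operator, the sum of the outer products of the vectors \<open>b i\<close> with themselves.\<close>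
  define A :: "real ^ 'n ^ 'n" where "A = (\<chi> r s. \<Sum>i\<in>J. b i $ r * b i $ s)"
  have "A *v x = (\<Sum>i\<in>J. (x \<bullet> b i) *\<^sub>R b i)" for x
  proof -
    have "(A *v x) $ r = (\<Sum>s\<in>UNIV. \<Sum>i\<in>J. b i $ r * b i $ s * x $ s)" for r
      by (simp add: A_def matrix_vector_mult_def sum_distrib_right)
    also have "\<dots> r = (\<Sum>i\<in>J. \<Sum>s\<in>UNIV. b i $ r * b i $ s * x $ s)" for r
      by (rule sum.swap)
    also have "\<dots> r = (\<Sum>i\<in>J. (x \<bullet> b i) *\<^sub>R b i) $ r" for r
      by (simp add: inner_vec_def sum_distrib_left mult_ac)
    finally show ?thesis
      by (simp add: vec_eq_iff)
  qed
  then have Ax: "(A *v x) \<bullet> x = (\<Sum>i\<in>J. (x \<bullet> b i)\<^sup>2)" for x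
    by (simp add: inner_sum_left inner_commute[of x] power2_eq_square)
  moreover have "transpose A = A"
    by (simp add: A_def transpose_def vec_eq_iff mult.commute)
  ultimately show ?thesis
    unfolding convex_quadratic_def
    by (intro exI[of _ A] exI[of _ 0] exI[of _ "- c"]) (simp add: sum_nonneg)
qed

theorem theorem1p1:
  fixes I :: "nat set" and d :: nat and V :: "(real ^ 'n) set"
  assumes "finite I" and "I \<noteq> {}" and "d = Max I"
    and "subspace V" and "dim V = d"
  shows "\<exists>S. S \<subseteq> V \<and> closed S \<and> convex S \<and>
           facial_dimension_signature S = I \<and>
           facially_exposed S \<and>
           (\<exists>f :: nat \<Rightarrow> real ^ 'n \<Rightarrow> real.
              (\<forall>i < card I - 1. convex_quadratic (f i)) \<and>
              S = {x \<in> V. \<forall>i < card I - 1. f i x \<le> 0}) \<and>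
           (0 \<in> I \<longrightarrow> compact S)"
proof -
  obtain B where B: "pairwise orthogonal B" "\<And>x. x \<in> B \<Longrightarrow> norm x = 1"
      "independent B" "card B = d" "span B = V"
    using orthonormal_basis_subspace[OF \<open>subspace V\<close>] \<open>dim V = d\<close> by metis
  obtain b where b: "bij_betw b {..<d} B"
    using B(3,4) by (metis ex_bij_betw_nat_finite atLeast0LessThan independent_imp_finite)
  interpret nested_cylinders b d I V
  proof
    fix i j assume ij: "i < d" "j < d"
    then have "b i \<in> B" "b j \<in> B" "b i = b j \<longleftrightarrow> i = j"
      using b by (auto simp: bij_betw_def inj_on_def)
    then show "b i \<bullet> b j = (if i = j then 1 else 0)"
      using B(1,2) by (auto simp: pairwise_def orthogonal_def norm_eq_1)
  qed (use b B assms in \<open>auto simp: bij_betw_def\<close>)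
  have "card (I - {d}) = card I - 1"
    using dim_in_I by simp
  then obtain e where e: "bij_betw e {..<card I - 1} (I - {d})"
    using \<open>finite I\<close> by (metis ex_bij_betw_nat_finite atLeast0LessThan finite_Diff)
  define f where "f i x = q (e i) x - (real d - real (e i))" for i x
  have "convex_quadratic (f i)" for i
    unfolding f_def q_def by (rule convex_quadratic_sum_squares)
  moreover have "S = {x \<in> V. \<forall>i < card I - 1. f i x \<le> 0}"
  proof -
    have "q d x \<le> real d - real d" for x
      by (simp add: q_def)
    then have "S = {x \<in> V. \<forall>n \<in> I - {d}. q n x \<le> real d - real n}"
      unfolding S_def by blast
    also have "\<dots> = {x \<in> V. \<forall>n \<in> e ` {..<card I - 1}. q n x \<le> real d - real n}"
      using e by (simp add: bij_betw_def)
    finally show ?thesis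
      by (auto simp: f_def)
  qed
  moreover have "facial_dimension_signature S = I"
    unfolding facial_dimension_signature_def by (simp add: face_dimensions)
  moreover have "facially_exposed S"
    unfolding facially_exposed_def using faces_exposed by blast
  moreover have "S \<subseteq> V"
    by (auto simp: S_def)
  ultimately show ?thesis
    using closed_S convex_S compact_S by blast
qed

end
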